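(* Let $R$ be a finite commutative ring with unit in which $1+1$ is invertible, and let $h:G\to R\times R$ be a surjective homomorphism from a finite group $G$ onto the additive group of the ring $R\times R$, with kernel $K=h^{-1}(0,0)$. Then $$\Delta[G]\le \Delta[K]\cdot|R|-|\mathrm{Spec}(R)|+\sum_{I\in\mathrm{Spec}(R)}\Delta[h^{-1}(I\times R)].$$ If moreover $R$ is local with maximal ideal $I_{\mathfrak m}$, then $\Delta[G]\le \Delta[K]\cdot|R|-1+\Delta[h^{-1}(I_{\mathfrak m}\times R)]$.
   Context: For a subset $A$ of a group $G$, a subset $B\subseteq G$ is a difference basis for $A$ if every $a\in A$ can be written as $a=xy^{-1}$ with $x,y\in B$. The difference size $\Delta[A]$ is the smallest cardinality of a difference basis for $A$. $\mathrm{Spec}(R)$ denotes the set of maximal ideals of $R$ (ideals are proper). A ring is local if it has a unique maximal ideal. *)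

theory Defs
  imports "HOL-Algebra.Algebra"
begin

definition difference_basis :: "('a, 'm) monoid_scheme \<Rightarrow> 'a set \<Rightarrow> 'a set \<Rightarrow> bool" where
  "difference_basis G A B \<longleftrightarrow>
     B \<subseteq> carrier G \<and> (\<forall>a\<in>A. \<exists>x\<in>B. \<exists>y\<in>B. a = x \<otimes>\<^bsub>G\<^esub> inv\<^bsub>G\<^esub> y)"

text \<open>
  A difference basis for \<open>A\<close> may be any subset of the ambient group, even if \<open>A\<close> is a subgroup.
  The value is meaningful only if \<open>A\<close> has a finite difference basis, in particular whenever
  \<open>G\<close> is a finite group and \<open>A \<subseteq> carrier G\<close>.
\<close>
definition difference_size :: "('a, 'm) monoid_scheme \<Rightarrow> 'a set \<Rightarrow> nat" where
  "difference_size G A = (LEAST n. \<exists>B. difference_basis G A B \<and> finite B \<and> card B = n)"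

text \<open>The set of maximal (not of all prime) ideals.\<close>
definition max_spec :: "('r, 'm) ring_scheme \<Rightarrow> 'r set set" where
  "max_spec R = {I. maximalideal I R}"

definition local_ring :: "('r, 'm) ring_scheme \<Rightarrow> bool" where
  "local_ring R \<longleftrightarrow> ring R \<and> (\<exists>!I. maximalideal I R)"

end

theory Submission
  imports Defs
begin

text \<open>
  The paraboloid \<open>{(x, x\<^sup>2)}\<close> is a difference basis for the set of all pairs \<open>(d, c)\<close> with
  \<open>d\<close> a unit: \<open>(x - y, x\<^sup>2 - y\<^sup>2) = (d, c)\<close> means \<open>x - y = d\<close> and \<open>x + y = c / d\<close>, which is solvable
  because \<open>2\<close> is invertible. Choosing preimages of its \<open>|R|\<close> points and multiplying them by a difference
  basis of \<open>K\<close> yields a difference basis for the corresponding part of \<open>G\<close>. If \<open>d\<close> is not a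
  unit, then it lies in a maximal ideal \<open>I\<close>, and a basis of \<open>h\<^sup>-\<^sup>1(I \<times> R)\<close> handles it. Right
  translations preserve difference bases, so all these bases can be made to share a point, which
  saves one element for every maximal ideal.
\<close>

section \<open>Difference sizes in groups: translates, unions, preimages under an
  epimorphism\<close>

lemma difference_size_le:
  assumes "difference_basis G A B" "finite B"
  shows "difference_size G A \<le> card B"
  unfolding difference_size_def by (rule Least_le) (use assms in blast)

text \<open>The finite basis \<open>B\<close> is what makes the \<open>LEAST\<close> a value that is
  really taken; in a finite group the whole carrier serves as \<open>B\<close>.\<close>

lemma difference_size_attained:
  assumes "difference_basis G A B" "finite B"
  obtains C where "difference_basis G A C" "finite C" "card C = difference_size G A"
proof -
  have "\<exists>C. difference_basis G A C \<and> finite C \<and> card C = difference_size G A"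
    unfolding difference_size_def by (rule LeastI[of _ "card B"]) (use assms in blast)
  with that show thesis by blast
qed

lemma (in group) difference_basis_carrier:
  assumes "A \<subseteq> carrier G"
  shows "difference_basis G A (carrier G)"
proof -
  have "a = a \<otimes> inv \<one>" if "a \<in> A" for a
    using assms that by auto
  with assms show ?thesis
    unfolding difference_basis_def by blast
qed

text \<open>The factor \<open>z\<close> cancels: (xz)(yz)^-1 = x y^-1.\<close>

lemma (in group) difference_basis_r_translate:
  assumes "difference_basis G A B" and [simp]: "z \<in> carrier G"
  shows "difference_basis G A ((\<lambda>x. x \<otimes> z) ` B)"
proof -
  have "x \<otimes> inv y = (x \<otimes> z) \<otimes> inv (y \<otimes> z)" if "x \<in> carrier G" "y \<in> carrier G" for x y
  proof -
    have "z \<otimes> (inv z \<otimes> inv y) = inv y"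
      using that by (simp flip: m_assoc)
    then show ?thesis
      using that by (simp add: inv_mult_group m_assoc)
  qed
  moreover have "B \<subseteq> carrier G"
    using assms(1) by (simp add: difference_basis_def)
  ultimately have "\<exists>x'\<in>(\<lambda>x. x \<otimes> z) ` B. \<exists>y'\<in>(\<lambda>x. x \<otimes> z) ` B. x \<otimes> inv y = x' \<otimes> inv y'"
    if "x \<in> B" "y \<in> B" for x y
    using that by blast
  moreover have "(\<lambda>x. x \<otimes> z) ` B \<subseteq> carrier G"
    using \<open>B \<subseteq> carrier G\<close> by auto
  ultimately show ?thesis
    using assms(1) unfolding difference_basis_def by metis
qed

text \<open>A translate of one optimal basis meets the other, so their union saves an element.
  Nonemptiness matters: the empty set has difference size 0, and nothing could be saved.\<close>

lemma (in group) difference_size_Un: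
  assumes "finite (carrier G)" "A \<subseteq> carrier G" "A' \<subseteq> carrier G" "A \<noteq> {}" "A' \<noteq> {}"
  shows "difference_size G (A \<union> A') + 1 \<le> difference_size G A + difference_size G A'"
proof -
  obtain B where B: "difference_basis G A B" "finite B" "card B = difference_size G A"
    using difference_size_attained[OF difference_basis_carrier] assms by metis
  obtain B' where B': "difference_basis G A' B'" "finite B'" "card B' = difference_size G A'"
    using difference_size_attained[OF difference_basis_carrier] assms by metis
  obtain b b' where b: "b \<in> B" "b' \<in> B'"
    using B(1) B'(1) assms(4,5) unfolding difference_basis_def by blast
  then have carr: "b \<in> carrier G" "b' \<in> carrier G"
    using B(1) B'(1) unfolding difference_basis_def by auto
  \<comment> \<open>Right multiplication by this element carries \<open>b'\<close> to
    \<open>b\<close>.\<close>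
  define C where "C = (\<lambda>x. x \<otimes> (inv b' \<otimes> b)) ` B'"
  have C: "difference_basis G A' C"
    unfolding C_def using B'(1) carr by (intro difference_basis_r_translate) auto
  have "b = b' \<otimes> (inv b' \<otimes> b)"
    using carr by (simp flip: m_assoc)
  then have "b \<in> B \<inter> C"
    using b unfolding C_def by blast
  moreover have "finite C" "card C \<le> card B'"
    using B'(2) by (auto simp: C_def card_image_le)
  moreover from \<open>b \<in> B \<inter> C\<close> have "card (B \<inter> C) > 0"
    using B(2) by (metis card_gt_0_iff empty_iff finite_Int)
  ultimately have "card (B \<union> C) + 1 \<le> card B + card B'"
    using card_Un_Int[OF B(2), of C] by linarith
  moreover have "difference_basis G (A \<union> A') (B \<union> C)"
    using B(1) C unfolding difference_basis_def by blast
  ultimately show ?thesis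
    using difference_size_le[of G "A \<union> A'" "B \<union> C"] B B' \<open>finite C\<close> by simp
qed

text \<open>Each \<open>F j\<close> joined to the union saves one element. The separate nonempty set
  \<open>A\<close> gives even the first of them something to share a point with, hence a saving of
  the full \<open>card J\<close>.\<close>

lemma (in group) difference_size_UN:
  assumes "finite (carrier G)" "finite J" "A \<subseteq> carrier G" "A \<noteq> {}"
    and "\<And>i. i \<in> J \<Longrightarrow> F i \<subseteq> carrier G" "\<And>i. i \<in> J \<Longrightarrow> F i \<noteq> {}"
  shows "difference_size G (A \<union> (\<Union>i\<in>J. F i)) + card J
           \<le> difference_size G A + (\<Sum>i\<in>J. difference_size G (F i))"
  using assms(2,5,6)
proof (induction J)
  case (insert j J)
  have "difference_size G ((A \<union> (\<Union>i\<in>J. F i)) \<union> F j) + 1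
          \<le> difference_size G (A \<union> (\<Union>i\<in>J. F i)) + difference_size G (F j)"
    using insert.prems assms(1,3,4) by (intro difference_size_Un) auto
  moreover have "(A \<union> (\<Union>i\<in>J. F i)) \<union> F j = A \<union> (\<Union>i\<in>insert j J. F i)"
    by blast
  ultimately show ?case
    using insert by simp
qed simp

text \<open>Differences of lifts of points of \<open>P\<close> reach \<open>g\<close> up to a kernel
  element, and a difference basis of the kernel supplies the correction.\<close>

lemma difference_size_preimage_le:
  assumes "group G" "group H" "finite (carrier G)" "h \<in> epi G H"
    and P: "P \<subseteq> carrier H" "finite P"
    and A: "A \<subseteq> carrier G" "\<And>g. g \<in> A \<Longrightarrow> \<exists>p\<in>P. \<exists>q\<in>P. h g = p \<otimes>\<^bsub>H\<^esub> inv\<^bsub>H\<^esub> q"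
  shows "difference_size G A \<le> difference_size G (kernel G H h) * card P"
proof -
  interpret G: group G by fact
  interpret H: group H by fact
  interpret group_hom G H h
    using assms(4) by unfold_locales (auto simp: epi_def)
  have surj: "h ` carrier G = carrier H"
    using assms(4) by (simp add: epi_def)
  \<comment> \<open>A set-theoretic section of \<open>h\<close>, in general not a
    homomorphism.\<close>
  define s where "s = inv_into (carrier G) h"
  have s: "s p \<in> carrier G" "h (s p) = p" if "p \<in> carrier H" for p
    unfolding s_def using that surj by (auto intro: inv_into_into f_inv_into_f)
  have "kernel G H h \<subseteq> carrier G"
    by (auto simp: kernel_def)
  then obtain D where D: "difference_basis G (kernel G H h) D" "finite D"
      "card D = difference_size G (kernel G H h)"
    using difference_size_attained[OF G.difference_basis_carrier] assms(3) by metis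
  have D_carr: "D \<subseteq> carrier G"
    using D(1) by (simp add: difference_basis_def)
  \<comment> \<open>The kernel factor stands on the right, so that in a quotient of two members a
    b^-1 appears between \<open>s p\<close> and the inverse of \<open>s q\<close>.\<close>
  define B where "B = (\<lambda>(d, p). s p \<otimes>\<^bsub>G\<^esub> d) ` (D \<times> P)"
  have "difference_basis G A B"
    unfolding difference_basis_def
  proof (intro conjI ballI)
    show "B \<subseteq> carrier G"
      unfolding B_def using s(1) P(1) D_carr by auto
  next
    fix g assume g: "g \<in> A"
    then have [simp]: "g \<in> carrier G"
      using A(1) by blast
    obtain p q where pq: "p \<in> P" "q \<in> P" "h g = p \<otimes>\<^bsub>H\<^esub> inv\<^bsub>H\<^esub> q"
      using A(2)[OF g] by blast
    then have [simp]: "p \<in> carrier H" "q \<in> carrier H"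
      using P(1) by auto
    note [simp] = s
    \<comment> \<open>This is g = (s p) k (s q)^-1 solved for \<open>k\<close>.\<close>
    define k where "k = inv\<^bsub>G\<^esub> (s p) \<otimes>\<^bsub>G\<^esub> g \<otimes>\<^bsub>G\<^esub> s q"
    have "h k = inv\<^bsub>H\<^esub> p \<otimes>\<^bsub>H\<^esub> (p \<otimes>\<^bsub>H\<^esub> inv\<^bsub>H\<^esub> q) \<otimes>\<^bsub>H\<^esub> q"
      unfolding k_def by (simp add: pq(3))
    also have "\<dots> = \<one>\<^bsub>H\<^esub>"
      by (simp add: H.m_assoc)
    finally have "k \<in> kernel G H h"
      by (simp add: kernel_def k_def)
    then obtain a b where ab: "a \<in> D" "b \<in> D" "k = a \<otimes>\<^bsub>G\<^esub> inv\<^bsub>G\<^esub> b"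
      using D(1) unfolding difference_basis_def by blast
    then have [simp]: "a \<in> carrier G" "b \<in> carrier G"
      using D_carr by auto
    have "g = s p \<otimes>\<^bsub>G\<^esub> k \<otimes>\<^bsub>G\<^esub> inv\<^bsub>G\<^esub> (s q)"
      unfolding k_def by (simp add: G.m_assoc) (simp flip: G.m_assoc)
    also have "\<dots> = (s p \<otimes>\<^bsub>G\<^esub> a) \<otimes>\<^bsub>G\<^esub> inv\<^bsub>G\<^esub> (s q \<otimes>\<^bsub>G\<^esub> b)"
      by (simp add: ab(3) G.inv_mult_group G.m_assoc)
    finally show "\<exists>x\<in>B. \<exists>y\<in>B. g = x \<otimes>\<^bsub>G\<^esub> inv\<^bsub>G\<^esub> y"
      unfolding B_def using ab pq by force
  qed
  moreover have "finite B"
    unfolding B_def using D(2) P(2) by simp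
  moreover have "card B \<le> card D * card P"
    unfolding B_def using card_image_le[of "D \<times> P"] D(2) P(2)
    by (metis card_cartesian_product finite_cartesian_product)
  ultimately show ?thesis
    using difference_size_le D(3) by (metis le_trans)
qed

section \<open>Commutative rings: maximal ideals and differences on the paraboloid\<close>

lemma (in cring) nonunit_in_maximalideal:
  assumes "finite (carrier R)" "d \<in> carrier R" "d \<notin> Units R"
  obtains I where "maximalideal I R" "d \<in> I"
proof -
  \<comment> \<open>Finiteness of the ring makes this family finite, so an inclusion-maximal member
    exists without Zorn's lemma.\<close>
  define S where "S = {I. ideal I R \<and> d \<in> I \<and> I \<noteq> carrier R}"
  have sub: "I \<subseteq> carrier R" if "I \<in> S" for I
    using that ideal.Icarr unfolding S_def by fastforce
  then have "finite S"
    using assms(1) by (meson Pow_iff finite_Pow_iff finite_subset subsetI)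
  \<comment> \<open>A multiple of \<open>d\<close> equal to one would make \<open>d\<close> a unit,
    by commutativity.\<close>
  have "\<one> \<notin> PIdl d"
    using assms(2,3) unfolding cgenideal_def Units_def by (auto simp: m_comm)
  then have "PIdl d \<in> S"
    unfolding S_def using assms(2) cgenideal_ideal cgenideal_self by auto
  then obtain M where M: "M \<in> S" "\<And>J. J \<in> S \<Longrightarrow> M \<subseteq> J \<Longrightarrow> M = J"
    using finite_has_maximal[OF \<open>finite S\<close>] by blast
  have "maximalideal M R"
  proof (rule maximalidealI)
    fix J assume J: "ideal J R" "M \<subseteq> J" "J \<subseteq> carrier R"
    \<comment> \<open>\<open>J\<close> contains \<open>d\<close> because \<open>M\<close> does, so a
      proper \<open>J\<close> belongs to \<open>S\<close>.\<close>
    show "J = M \<or> J = carrier R"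
      using J M unfolding S_def by blast
  qed (use M(1) in \<open>auto simp: S_def\<close>)
  with M(1) show thesis
    by (intro that) (auto simp: S_def)
qed

lemma (in cring) paraboloid_difference:
  assumes two: "\<one> \<oplus> \<one> \<in> Units R" and d: "d \<in> Units R" and c [simp]: "c \<in> carrier R"
  obtains x y where "x \<in> carrier R" "y \<in> carrier R" "x \<ominus> y = d" "x \<otimes> x \<ominus> y \<otimes> y = c"
proof -
  define w where "w = inv (\<one> \<oplus> \<one>)"
  define e where "e = inv d"
  have carr [simp]: "w \<in> carrier R" "e \<in> carrier R" "d \<in> carrier R"
    using two d by (auto simp: w_def e_def)
  have w: "w \<oplus> w = \<one>"
    using Units_l_inv[OF two] by (simp add: w_def[symmetric] r_distr)
  have e: "e \<otimes> d = \<one>"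
    using Units_l_inv[OF d] by (simp add: e_def)
  \<comment> \<open>With \<open>w\<close> as 1/2 and \<open>e\<close> as 1/d, \<open>x\<close> and
    \<open>y\<close> are half the sum and half the difference of c/d and d.\<close>
  define x where "x = w \<otimes> (c \<otimes> e \<oplus> d)"
  define y where "y = w \<otimes> (c \<otimes> e \<ominus> d)"
  have xy [simp]: "x \<in> carrier R" "y \<in> carrier R"
    by (auto simp: x_def y_def)
  \<comment> \<open>A polynomial identity in \<open>w\<close>, \<open>c\<close>, \<open>e\<close>,
    \<open>d\<close>; that \<open>w \<oplus> w\<close> is one enters only afterwards.\<close>
  have "x \<ominus> y = (w \<oplus> w) \<otimes> d"
    unfolding x_def y_def using carr c by algebra
  then have diff: "x \<ominus> y = d"
    by (simp add: w)
  have "x \<oplus> y = (w \<oplus> w) \<otimes> (c \<otimes> e)"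
    unfolding x_def y_def using carr c by algebra
  then have sum: "x \<oplus> y = c \<otimes> e"
    by (simp add: w)
  have "x \<otimes> x \<ominus> y \<otimes> y = (x \<oplus> y) \<otimes> (x \<ominus> y)"
    using xy by algebra
  also have "\<dots> = c"
    unfolding diff sum by (simp add: m_assoc e)
  finally show thesis
    using that[OF xy diff] by simp
qed

section \<open>Covering the group by the unit part and the maximal ideal parts\<close>

theorem theorem5p2:
  fixes R :: "('r, 'm) ring_scheme" and G :: "('g, 'n) monoid_scheme" and h :: "'g \<Rightarrow> 'r \<times> 'r"
    and K :: "'g set"
  assumes "cring R" and "finite (carrier R)"
    and "\<one>\<^bsub>R\<^esub> \<oplus>\<^bsub>R\<^esub> \<one>\<^bsub>R\<^esub> \<in> Units R"
    and "group G" and "finite (carrier G)"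
    and "h \<in> epi G (add_monoid (RDirProd R R))"
    and "K = kernel G (add_monoid (RDirProd R R)) h"
  shows "int (difference_size G (carrier G))
           \<le> int (difference_size G K) * int (card (carrier R)) - int (card (max_spec R))
             + (\<Sum>I\<in>max_spec R. int (difference_size G {g \<in> carrier G. h g \<in> I \<times> carrier R}))
       \<and> (\<forall>I\<^sub>m. local_ring R \<and> maximalideal I\<^sub>m R \<longrightarrow>
           int (difference_size G (carrier G))
             \<le> int (difference_size G K) * int (card (carrier R)) - 1
               + int (difference_size G {g \<in> carrier G. h g \<in> I\<^sub>m \<times> carrier R}))"
proof -
  interpret R: cring R by fact
  interpret G: group G by fact
  define H where "H = add_monoid (RDirProd R R)"
  interpret H: group H
    unfolding H_def RDirProd_add_monoid by (intro DirProd_group R.add.is_group)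
  have h: "h \<in> epi G H"
    using assms(6) by (simp add: H_def)
  interpret group_hom G H h
    using h by unfold_locales (auto simp: epi_def)
  have carrier_H: "carrier H = carrier R \<times> carrier R"
    by (simp add: H_def RDirProd_carrier)
  have surj: "h ` carrier G = carrier R \<times> carrier R"
    using h by (simp add: epi_def carrier_H)
  \<comment> \<open>As \<open>H\<close> is additive, the quotient in the definition of a difference
    basis becomes componentwise subtraction.\<close>
  have H_diff: "(x, u) \<otimes>\<^bsub>H\<^esub> inv\<^bsub>H\<^esub> (y, v) = (x \<ominus>\<^bsub>R\<^esub> y, u \<ominus>\<^bsub>R\<^esub> v)"
    if "x \<in> carrier R" "y \<in> carrier R" "u \<in> carrier R" "v \<in> carrier R" for x y u v
    using that unfolding H_def RDirProd_add_monoid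
    by (simp add: inv_DirProd[OF R.add.is_group R.add.is_group] a_minus_def a_inv_def)
  define P where "P = (\<lambda>x. (x, x \<otimes>\<^bsub>R\<^esub> x)) ` carrier R"
  define U where "U = {g \<in> carrier G. fst (h g) \<in> Units R}"
  define F where "F I = {g \<in> carrier G. h g \<in> I \<times> carrier R}" for I
  have "difference_size G U \<le> difference_size G (kernel G H h) * card P"
  proof (rule difference_size_preimage_le[OF assms(4) H.is_group assms(5) h])
    show "P \<subseteq> carrier H" "finite P" "U \<subseteq> carrier G"
      using assms(2) by (auto simp: P_def U_def carrier_H)
  next
    fix g assume g: "g \<in> U"
    obtain d c where dc: "h g = (d, c)" by force
    with g have "d \<in> Units R"
      by (simp add: U_def)
    have "h g \<in> carrier R \<times> carrier R"
      using g surj by (auto simp: U_def)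
    then have "c \<in> carrier R"
      by (simp add: dc)
    with \<open>d \<in> Units R\<close> obtain x y where xy: "x \<in> carrier R" "y \<in> carrier R" "x \<ominus>\<^bsub>R\<^esub> y = d"
        "x \<otimes>\<^bsub>R\<^esub> x \<ominus>\<^bsub>R\<^esub> y \<otimes>\<^bsub>R\<^esub> y = c"
      by (rule R.paraboloid_difference[OF assms(3)])
    then have "h g = (x, x \<otimes>\<^bsub>R\<^esub> x) \<otimes>\<^bsub>H\<^esub> inv\<^bsub>H\<^esub> (y, y \<otimes>\<^bsub>R\<^esub> y)"
      by (simp add: dc H_diff)
    then show "\<exists>p\<in>P. \<exists>q\<in>P. h g = p \<otimes>\<^bsub>H\<^esub> inv\<^bsub>H\<^esub> q"
      using xy(1,2) unfolding P_def by blast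
  qed
  also have "\<dots> \<le> difference_size G K * card (carrier R)"
    unfolding P_def assms(7) H_def[symmetric]
    by (intro mult_le_mono2 card_image_le assms(2))
  finally have U: "difference_size G U \<le> difference_size G K * card (carrier R)" .
  have ideal_max: "ideal I R" if "I \<in> max_spec R" for I
    using that by (simp add: max_spec_def maximalideal_def)
  have fin: "finite (max_spec R)"
  proof (rule finite_subset)
    show "max_spec R \<subseteq> Pow (carrier R)"
      using ideal_max ideal.Icarr by fastforce
  qed (simp add: assms(2))
  \<comment> \<open>All pieces of the cover must be nonempty for the savings: a preimage of (1, 0)
    lies in \<open>U\<close>, the identity of \<open>G\<close> in every \<open>F I\<close>.\<close>
  have U_ne: "U \<noteq> {}"
  proof -
    have "(\<one>\<^bsub>R\<^esub>, \<zero>\<^bsub>R\<^esub>) \<in> h ` carrier G"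
      by (simp add: surj)
    then obtain g where "g \<in> carrier G" "h g = (\<one>\<^bsub>R\<^esub>, \<zero>\<^bsub>R\<^esub>)"
      by (metis imageE)
    then have "g \<in> U"
      by (simp add: U_def)
    then show ?thesis by blast
  qed
  have F_ne: "F I \<noteq> {}" if "I \<in> max_spec R" for I
  proof -
    have "\<one>\<^bsub>H\<^esub> = (\<zero>\<^bsub>R\<^esub>, \<zero>\<^bsub>R\<^esub>)"
      unfolding H_def RDirProd_add_monoid by simp
    moreover have "\<zero>\<^bsub>R\<^esub> \<in> I"
      by (intro additive_subgroup.zero_closed ideal.axioms(1) ideal_max that)
    ultimately have "\<one>\<^bsub>G\<^esub> \<in> F I"
      by (simp add: F_def)
    then show ?thesis by blast
  qed
  have "carrier G = U \<union> (\<Union>I\<in>max_spec R. F I)"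
  proof (intro equalityI subsetI)
    fix g assume g: "g \<in> carrier G"
    then have hg: "h g \<in> carrier R \<times> carrier R"
      using surj by blast
    show "g \<in> U \<union> (\<Union>I\<in>max_spec R. F I)"
    proof (cases "fst (h g) \<in> Units R")
      case False
      then obtain I where "maximalideal I R" "fst (h g) \<in> I"
        using R.nonunit_in_maximalideal[OF assms(2)] hg by (metis mem_Times_iff)
      then show ?thesis
        using g hg by (auto simp: F_def max_spec_def mem_Times_iff)
    qed (simp add: U_def g)
  qed (auto simp: U_def F_def)
  \<comment> \<open>The number of maximal ideals stays on the left while the values are natural
    numbers, where subtraction truncates; it changes sides once they are integers.\<close>
  then have "difference_size G (carrier G) + card (max_spec R)
      \<le> difference_size G U + (\<Sum>I\<in>max_spec R. difference_size G (F I))"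
    using G.difference_size_UN[OF assms(5) fin _ U_ne, of F] F_ne
    by (simp add: U_def F_def)
  with U have "int (difference_size G (carrier G) + card (max_spec R))
      \<le> int (difference_size G K * card (carrier R) + (\<Sum>I\<in>max_spec R. difference_size G (F I)))"
    by linarith
  then have main: "int (difference_size G (carrier G))
      \<le> int (difference_size G K) * int (card (carrier R)) - int (card (max_spec R))
        + (\<Sum>I\<in>max_spec R. int (difference_size G (F I)))"
    by simp
  \<comment> \<open>In the local case the sum has a single term and the cardinality is 1.\<close>
  have "max_spec R = {I}" if "local_ring R" "maximalideal I R" for I
    using that by (auto simp: local_ring_def max_spec_def)
  then show ?thesis
    using main by (auto simp: F_def)
qed

end
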